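(* Let $X\subset[n]$ be nonempty, let $\mathcal{F}\subset\binom{X}{k}$, let $R,T\subset X$ be sets with $|R|,|T|<k$, $R\cap T=\emptyset$ and $r:=\min X\in R$, and let $i\in X\setminus R$. Consider the following properties. (P1) For all disjoint $U,V\subset X$ with $|U|=|V|$ and $r\in U$, if $S_{U,V}(\mathcal{F})\ne\mathcal{F}$, then $|V|\ge|R|$. (P2) There exists $F\in\mathcal{F}$ with $R\cap F=\emptyset$. (P3) $R$ is non-full in $\mathcal{F}$. (P4) $R\cup\{i\}$ is non-full in $\mathcal{F}$. (P5) There exists $F\in\mathcal{F}$ with $R\cap F=\emptyset$ and $i\in F$. (P6) There exists $F\in\mathcal{F}$ with $(R\cup T)\cap F=\emptyset$. (P7) Every $F\in\mathcal{F}$ with $(R\cup T)\cap F=\emptyset$ satisfies $i\in F$. Then: (i) If (P1)--(P3) hold, then there exists a pair $(U,V)$ satisfying $\mathbf{Q}$ for $\mathcal{F}$ with $R\subset U$. (ii) If (P1)--(P5) hold, then there exists a pair $(U,V)$ satisfying $\mathbf{Q}$ for $\mathcal{F}$ with $R\subset U$ and $i\notin V$. (iii) If (P1)--(P3) and (P6) hold, then there exists a pair $(U,V)$ satisfying $\mathbf{Q}$ for $\mathcal{F}$ with $T\cap V=\emptyset$ and $R\subset U$. (iv) If (P1)--(P4) and (P6)--(P7) hold, then there exists a pair $(U,V)$ satisfying $\mathbf{Q}$ for $\mathcal{F}$ with $(T\cup\{i\})\cap V=\emptyset$ and $R\subset U$.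
   Context: $[n]=\{1,\dots,n\}$; $\binom{X}{k}$ is the family of all $k$-subsets of $X$. Lexicographic order: for sets $A,B$ of integers write $A\prec B$ if either $B\subset A$ or $\min(A\setminus B)<\min(B\setminus A)$. For a $k$-set $S\subset X$, $i_{\mathrm{lex}}(S)$ is its position in the lexicographic order on $\binom{X}{k}$. Shift: for disjoint sets $U,V$ with $|U|=|V|$, put $S_{U,V}(F)=(F\setminus V)\cup U$ if $F\cap(U\cup V)=V$, and $S_{U,V}(F)=F$ otherwise; for a family, $S_{U,V}(\mathcal{F})=\{S_{U,V}(F):F\in\mathcal{F}\}\cup\{F\in\mathcal{F}:S_{U,V}(F)\in\mathcal{F}\}$. Property $\mathbf{Q}$: let $U,V\subset X$ with $U\cap V=\emptyset$, $|U|=|V|$ and $U\prec V$. The pair $(U,V)$ satisfies $\mathbf{Q}$ for $\mathcal{F}$ if $\sum_{S\in S_{U,V}(\mathcal{F})}i_{\mathrm{lex}}(S)<\sum_{S\in\mathcal{F}}i_{\mathrm{lex}}(S)$ and for every $V'\subsetneq V$ there exists $U'\subsetneq U$ such that $U'\prec V'$, $|U'|=|V'|$ and $S_{U',V'}(\mathcal{F})=\mathcal{F}$. Non-full: for $C\subset X$ with $|C|\le k$, let $\mathcal{E}^k_C=\{C\cup D: D\subset\{x\in X:x>\max C\},\ |D|=k-|C|\}$ (with $\max\emptyset=0$). The set $C$ is non-full in $\mathcal{F}$ if $\mathcal{E}^k_C\setminus\mathcal{F}\ne\emptyset$. *)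

theory Defs
  imports "HOL-Library.Ramsey"
begin

text \<open>
  Inclusion is not strict here, so the order is reflexive. This is essential: the
  proper subset \<open>V' = {}\<close> in \<open>satisfies_Q\<close> below forces \<open>U' = {}\<close> and hence needs
  \<open>{} \<prec>\<^sub>l {}\<close>. The minimum of the empty set is read as infinity; a proper subset never
  precedes its superset.
\<close>

definition lex_prec :: "nat set \<Rightarrow> nat set \<Rightarrow> bool" (infix \<open>\<prec>\<^sub>l\<close> 50) where
  "A \<prec>\<^sub>l B \<longleftrightarrow> B \<subseteq> A \<or> (A - B \<noteq> {} \<and> B - A \<noteq> {} \<and> Min (A - B) < Min (B - A))"

definition i_lex :: "nat set \<Rightarrow> nat \<Rightarrow> nat set \<Rightarrow> nat" where
  "i_lex X k S = card {A \<in> nsets X k. A \<prec>\<^sub>l S}"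

definition shift_set :: "'a set \<Rightarrow> 'a set \<Rightarrow> 'a set \<Rightarrow> 'a set" where
  "shift_set U V F = (if F \<inter> (U \<union> V) = V then (F - V) \<union> U else F)"

definition shift :: "'a set \<Rightarrow> 'a set \<Rightarrow> 'a set set \<Rightarrow> 'a set set" where
  "shift U V \<F> = shift_set U V ` \<F> \<union> {F \<in> \<F>. shift_set U V F \<in> \<F>}"

definition satisfies_Q ::
  "nat set \<Rightarrow> nat \<Rightarrow> nat set set \<Rightarrow> nat set \<Rightarrow> nat set \<Rightarrow> bool" where
  "satisfies_Q X k \<F> U V \<longleftrightarrow>
     U \<subseteq> X \<and> V \<subseteq> X \<and> U \<inter> V = {} \<and> card U = card V \<and> U \<prec>\<^sub>l V \<and>
     (\<Sum>S\<in>shift U V \<F>. i_lex X k S) < (\<Sum>S\<in>\<F>. i_lex X k S) \<and>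
     (\<forall>V'. V' \<subset> V \<longrightarrow>
        (\<exists>U'. U' \<subset> U \<and> U' \<prec>\<^sub>l V' \<and> card U' = card V' \<and> shift U' V' \<F> = \<F>))"

definition max0 :: "nat set \<Rightarrow> nat" where
  "max0 C = (if C = {} then 0 else Max C)"

text \<open>Only meaningful for \<open>C \<subseteq> X\<close> with \<open>card C \<le> k\<close>.\<close>

definition end_ext :: "nat set \<Rightarrow> nat \<Rightarrow> nat set \<Rightarrow> nat set set" where
  "end_ext X k C = {C \<union> D | D. D \<subseteq> {x \<in> X. x > max0 C} \<and> card D = k - card C}"

definition non_full :: "nat set \<Rightarrow> nat \<Rightarrow> nat set set \<Rightarrow> nat set \<Rightarrow> bool" where
  "non_full X k \<F> C \<longleftrightarrow> end_ext X k C - \<F> \<noteq> {}"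

end

theory Submission
  imports Defs
begin

text \<open>
  If some \<open>E \<supseteq> R\<close> lies outside \<open>\<F>\<close> while some \<open>F \<in> \<F>\<close> misses \<open>R\<close>, then
  \<open>(E - F, F - E)\<close> is a pair that changes \<open>\<F>\<close>. Among all changing pairs \<open>(U, V)\<close> with \<open>R \<subseteq> U\<close> and
  \<open>V\<close> avoiding a prescribed set \<open>W\<close>, one with \<open>|V|\<close> minimal satisfies \<open>\<^bold>Q\<close>: it moves sets to sets
  containing the least element of \<open>X\<close>, which come earlier in the lexicographic order, and for
  \<open>V' \<subset> V\<close> any \<open>U'\<close> of the right size works, by (P1) when \<open>|V'| < |R|\<close> (taking \<open>min X \<in> U'\<close>) and by
  minimality otherwise (taking \<open>R \<subseteq> U'\<close>). The four claims differ in the choice of \<open>E\<close>, \<open>F\<close>, \<open>W\<close>.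
\<close>

section \<open>Lexicographic order and positions\<close>

lemma nsets_finite_card: "A \<in> nsets X k \<Longrightarrow> A \<subseteq> X \<and> finite A \<and> card A = k"
  by (auto simp: nsets_def)

lemma finite_card_eq_Diff_nonempty:
  assumes "finite A" "finite B" "card A = card B" "A \<noteq> B"
  shows "A - B \<noteq> {}"
  using assms card_subset_eq by blast

text \<open>\<open>Min X\<close> belongs to \<open>A - B\<close>, while every element of
  \<open>B - A\<close> is a different element of \<open>X\<close> and hence larger.\<close>

lemma lex_prec_if_Min_mem:
  assumes "finite X" "A \<subseteq> X" "B \<subseteq> X" "Min X \<in> A" "Min X \<notin> B" "B - A \<noteq> {}"
  shows "A \<prec>\<^sub>l B"
proof -
  have fin: "finite (A - B)" "finite (B - A)"
    using assms(1-3) by (meson finite_Diff finite_subset)+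
  have "Min (A - B) \<le> Min X"
    using fin assms by (intro Min_le) auto
  moreover have "Min X < Min (B - A)"
  proof -
    have "Min (B - A) \<in> B - A"
      using fin(2) assms(6) by (rule Min_in)
    then show ?thesis
      using assms Min_le[of X "Min (B - A)"] by (metis DiffE le_neq_implies_less subsetD)
  qed
  ultimately show ?thesis
    using assms unfolding lex_prec_def by auto
qed

lemma not_lex_prec_if_Min_mem:
  assumes "finite X" "A \<subseteq> X" "B \<subseteq> X" "Min X \<in> A" "Min X \<notin> B"
  shows "\<not> B \<prec>\<^sub>l A"
proof
  assume prec: "B \<prec>\<^sub>l A"
  have fin: "finite (A - B)" "finite (B - A)"
    using assms(1-3) by (meson finite_Diff finite_subset)+
  from prec assms(4,5) have ne: "B - A \<noteq> {}" and less: "Min (B - A) < Min (A - B)"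
    unfolding lex_prec_def by auto
  have "Min (A - B) \<le> Min X"
    using fin assms by (intro Min_le) auto
  moreover have "Min X \<le> Min (B - A)"
    using Min_in[OF fin(2) ne] assms by (intro Min_le) auto
  ultimately show False
    using less by simp
qed

text \<open>All sets counted for \<open>A\<close> contain \<open>Min X\<close> and are therefore
  counted for \<open>B\<close> too. By reflexivity \<open>B\<close> counts itself as well, and it is
  not counted for \<open>A\<close>.\<close>

lemma i_lex_less_if_Min_mem:
  assumes "finite X" "A \<in> nsets X k" "B \<in> nsets X k" "Min X \<in> A" "Min X \<notin> B"
  shows "i_lex X k A < i_lex X k B"
proof -
  note A = nsets_finite_card[OF assms(2)] and B = nsets_finite_card[OF assms(3)]
  have "C \<prec>\<^sub>l B" if C: "C \<in> nsets X k" "C \<prec>\<^sub>l A" for C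
  proof -
    note C' = nsets_finite_card[OF C(1)]
    have "Min X \<in> C"
      using not_lex_prec_if_Min_mem[of X A C] assms A C' C(2) by blast
    moreover from this have "B - C \<noteq> {}"
      using finite_card_eq_Diff_nonempty[of B C] B C' assms(5) by metis
    ultimately show ?thesis
      using lex_prec_if_Min_mem[of X C B] assms B C' by blast
  qed
  moreover have "B \<prec>\<^sub>l B"
    by (simp add: lex_prec_def)
  moreover have "\<not> B \<prec>\<^sub>l A"
    using not_lex_prec_if_Min_mem[of X A B] assms A B by blast
  ultimately have "{C \<in> nsets X k. C \<prec>\<^sub>l A} \<subset> {C \<in> nsets X k. C \<prec>\<^sub>l B}"
    using assms(3) by blast
  moreover have "finite {C \<in> nsets X k. C \<prec>\<^sub>l B}"
    using assms(1) by (simp add: finite_imp_finite_nsets)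
  ultimately show ?thesis
    unfolding i_lex_def by (rule psubset_card_mono[rotated])
qed

section \<open>Shifts of families\<close>

lemma shift_empty [simp]: "shift {} {} \<F> = \<F>"
  by (auto simp: shift_def shift_set_def)

lemma shift_set_neq_D:
  assumes "shift_set U V F \<noteq> F"
  shows "F \<inter> (U \<union> V) = V" "shift_set U V F = (F - V) \<union> U"
  using assms by (auto simp: shift_set_def split: if_splits)

lemma shift_set_mem_nsets:
  assumes "F \<in> nsets X k" "finite X" "U \<subseteq> X" "V \<subseteq> X" "U \<inter> V = {}" "card U = card V"
  shows "shift_set U V F \<in> nsets X k"
proof (cases "F \<inter> (U \<union> V) = V")
  case True
  note F = nsets_finite_card[OF assms(1)]
  have fin: "finite U" "finite V"
    using assms(2-4) finite_subset by blast+
  have "V \<subseteq> F" "(F - V) \<inter> U = {}"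
    using True assms(5) by auto
  then have "card ((F - V) \<union> U) = k"
    using F fin assms(6) card_mono[of F V] by (simp add: card_Un_disjoint card_Diff_subset)
  then show ?thesis
    using True F fin assms(3) by (auto simp: shift_set_def nsets_def)
qed (use assms in \<open>simp add: shift_set_def\<close>)

lemma shift_neq_D:
  assumes "shift U V \<F> \<noteq> \<F>"
  obtains F where "F \<in> \<F>" "shift_set U V F \<notin> \<F>"
proof -
  have "\<exists>F\<in>\<F>. shift_set U V F \<notin> \<F>"
  proof (rule ccontr)
    assume "\<not> ?thesis"
    then have "shift U V \<F> = \<F>"
      by (auto simp: shift_def)
    with assms show False ..
  qed
  with that show thesis by blast
qed

text \<open>Writing the shift as the image of \<open>\<F>\<close> under a single map allows sums
  over it to be reindexed.\<close>

lemma shift_eq_image: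
  "shift U V \<F> = (\<lambda>F. if shift_set U V F \<in> \<F> then F else shift_set U V F) ` \<F>"
proof -
  have "shift_set U V F \<in> (\<lambda>F. if shift_set U V F \<in> \<F> then F else shift_set U V F) ` \<F>"
    if "F \<in> \<F>" for F
  proof (cases "shift_set U V F \<in> \<F>")
    case True
    \<comment> \<open>\<open>shift_set\<close> is idempotent, so an image already in
      \<open>\<F>\<close> stays put and serves as its own preimage.\<close>
    have "shift_set U V (shift_set U V F) = shift_set U V F"
      by (auto simp: shift_set_def)
    with True show ?thesis
      by (intro image_eqI[of _ _ "shift_set U V F"]) simp_all
  qed (use that in auto)
  then show ?thesis
    unfolding shift_def by (auto split: if_splits)
qed

text \<open>A set that moves leaves \<open>\<F>\<close>, so it cannot collide with one that stays.
  Two moved sets are told apart by undoing the exchange.\<close>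

lemma inj_on_shift:
  assumes "U \<inter> V = {}"
  shows "inj_on (\<lambda>F. if shift_set U V F \<in> \<F> then F else shift_set U V F) \<F>"
proof -
  have eq: "F = G"
    if "F \<in> \<F>" "G \<in> \<F>" "shift_set U V F \<notin> \<F>" "shift_set U V G \<notin> \<F>"
      "shift_set U V F = shift_set U V G" for F G
  proof -
    have "shift_set U V F \<noteq> F" "shift_set U V G \<noteq> G"
      using that by auto
    note F = shift_set_neq_D[OF this(1)] and G = shift_set_neq_D[OF this(2)]
    have "F = (shift_set U V F - U) \<union> V"
      unfolding F(2) using F(1) assms by blast
    also have "\<dots> = G"
      unfolding that(5) G(2) using G(1) assms by blast
    finally show ?thesis .
  qed
  show ?thesis
    by (rule inj_onI) (metis eq)
qed

text \<open>Each moved set gains \<open>Min X\<close>, which it lacked, so its position drops; at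
  least one set moves.\<close>

lemma sum_i_lex_shift_less:
  assumes "finite X" "\<F> \<subseteq> nsets X k" "U \<subseteq> X" "V \<subseteq> X" "U \<inter> V = {}" "card U = card V"
    "Min X \<in> U" "shift U V \<F> \<noteq> \<F>"
  shows "(\<Sum>S\<in>shift U V \<F>. i_lex X k S) < (\<Sum>S\<in>\<F>. i_lex X k S)"
proof -
  let ?g = "\<lambda>F. if shift_set U V F \<in> \<F> then F else shift_set U V F"
  have fin: "finite \<F>"
    using assms(1,2) finite_subset finite_imp_finite_nsets by blast
  have less: "i_lex X k (shift_set U V F) < i_lex X k F"
    if F: "F \<in> \<F>" "shift_set U V F \<notin> \<F>" for F
  proof -
    have "shift_set U V F \<noteq> F"
      using F by auto
    from shift_set_neq_D[OF this] assms(5,7)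
    have "Min X \<in> shift_set U V F" "Min X \<notin> F"
      by auto
    then show ?thesis
      using F assms by (intro i_lex_less_if_Min_mem shift_set_mem_nsets) auto
  qed
  obtain G where G: "G \<in> \<F>" "shift_set U V G \<notin> \<F>"
    using shift_neq_D assms(8) by blast
  have "(\<Sum>S\<in>shift U V \<F>. i_lex X k S) = (\<Sum>F\<in>\<F>. i_lex X k (?g F))"
    unfolding shift_eq_image by (subst sum.reindex[OF inj_on_shift[OF assms(5)]]) (simp only: o_def)
  also have "\<dots> < (\<Sum>F\<in>\<F>. i_lex X k F)"
    using fin less G by (intro sum_strict_mono_ex1) (auto simp: less_imp_le)
  finally show ?thesis .
qed

section \<open>Minimal changing pairs\<close>

text \<open>The last hypothesis on \<open>F\<close> says that the initial pair
  \<open>(E - F, F - E)\<close> already respects the forbidden set \<open>W\<close>.\<close>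

lemma exists_satisfies_Q:
  assumes "finite X" "\<F> \<subseteq> nsets X k" "R \<subseteq> X" "Min X \<in> R"
    and P1: "\<And>U V. U \<subseteq> X \<Longrightarrow> V \<subseteq> X \<Longrightarrow> U \<inter> V = {} \<Longrightarrow> card U = card V \<Longrightarrow> Min X \<in> U \<Longrightarrow>
      shift U V \<F> \<noteq> \<F> \<Longrightarrow> card R \<le> card V"
    and E: "E \<in> nsets X k" "R \<subseteq> E" "E \<notin> \<F>"
    and F: "F \<in> \<F>" "R \<inter> F = {}" "W \<inter> (F - E) = {}"
  shows "\<exists>U V. satisfies_Q X k \<F> U V \<and> W \<inter> V = {} \<and> R \<subseteq> U"
proof -
  \<comment> \<open>The order \<open>U \<prec>\<^sub>l V\<close> and the drop of the sum are left
    out: both will follow from \<open>Min X\<close> lying in \<open>U\<close>.\<close>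
  define P where "P = (\<lambda>(U, V). U \<subseteq> X \<and> V \<subseteq> X \<and> U \<inter> V = {} \<and> card U = card V \<and> R \<subseteq> U \<and>
    W \<inter> V = {} \<and> shift U V \<F> \<noteq> \<F>)"
  have "P (E - F, F - E)"
  proof -
    have F': "F \<in> nsets X k"
      using F(1) assms(2) by blast
    note Ef = nsets_finite_card[OF E(1)] and Ff = nsets_finite_card[OF F']
    have "F \<inter> ((E - F) \<union> (F - E)) = F - E" "(F - (F - E)) \<union> (E - F) = E"
      by blast+
    then have "shift_set (E - F) (F - E) F = E"
      by (simp add: shift_set_def)
    then have "E \<in> shift (E - F) (F - E) \<F>"
      using F(1) unfolding shift_def by blast
    then have "shift (E - F) (F - E) \<F> \<noteq> \<F>"
      using E(3) by blast
    moreover have "card (E - F) = card (F - E)"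
      using Ef Ff card_le_sym_Diff[of E F] card_le_sym_Diff[of F E] by simp
    ultimately show ?thesis
      using Ef Ff E(2) F(2,3) unfolding P_def by blast
  qed
  then obtain U V where UV: "P (U, V)"
    and least: "\<And>U' V'. P (U', V') \<Longrightarrow> card V \<le> card V'"
    using ex_has_least_nat[of P _ "\<lambda>(U, V). card V"] by fastforce
  have U: "U \<subseteq> X" "V \<subseteq> X" "U \<inter> V = {}" "card U = card V" "R \<subseteq> U" "W \<inter> V = {}"
    "shift U V \<F> \<noteq> \<F>"
    using UV unfolding P_def by auto
  have fin: "finite U" "finite V"
    using U(1,2) assms(1) finite_subset by blast+
  have r: "Min X \<in> U"
    using assms(4) U(5) by blast
  have "\<exists>U'. U' \<subset> U \<and> U' \<prec>\<^sub>l V' \<and> card U' = card V' \<and> shift U' V' \<F> = \<F>"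
    if V': "V' \<subset> V" for V'
  proof (cases "V' = {}")
    case True
    then show ?thesis
      using r by (intro exI[of _ "{}"]) (auto simp: lex_prec_def)
  next
    case False
    have fV': "finite V'" "card V' < card U"
      using V' fin U(4) by (auto intro: finite_subset psubset_card_mono)
    \<comment> \<open>Two of the demands on \<open>U'\<close> follow from its size and from
      \<open>Min X\<close>; only the invariance of \<open>\<F>\<close> remains to be
      arranged.\<close>
    have work: "U' \<subset> U \<and> U' \<prec>\<^sub>l V'"
      if "U' \<subseteq> U" "Min X \<in> U'" "card U' = card V'" for U'
    proof
      show "U' \<subset> U"
        using that fV'(2) by auto
      show "U' \<prec>\<^sub>l V'"
        using that V' U(1-3) False r by (intro lex_prec_if_Min_mem[OF assms(1)]) blast+
    qed
    show ?thesis
    proof (cases "card V' < card R")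
      case True
      \<comment> \<open>Since \<open>V'\<close> is nonempty, a set \<open>U'\<close> of the same
        size has room for \<open>Min X\<close>.\<close>
      have "1 \<le> card V'"
        using False fV'(1) by (simp add: Suc_le_eq card_gt_0_iff)
      then obtain U' where U': "{Min X} \<subseteq> U'" "U' \<subseteq> U" "card U' = card V'"
        using exists_subset_between[of "{Min X}" "card V'" U] fV'(2) r fin(1) by auto
      have "shift U' V' \<F> = \<F>"
      proof (rule ccontr)
        assume "shift U' V' \<F> \<noteq> \<F>"
        then have "card R \<le> card V'"
          using U' U V' by (intro P1[of U' V']) auto
        with True show False by simp
      qed
      with work[of U'] U' show ?thesis by blast
    next
      case False
      then obtain U' where U': "R \<subseteq> U'" "U' \<subseteq> U" "card U' = card V'"
        using exists_subset_between[of R "card V'" U] fV'(2) U(5) fin(1) by auto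
      have "shift U' V' \<F> = \<F>"
      proof (rule ccontr)
        assume "shift U' V' \<F> \<noteq> \<F>"
        \<comment> \<open>\<open>V'\<close> inherits from \<open>V\<close> that it avoids
          \<open>W\<close>, and \<open>U'\<close> still contains \<open>R\<close>, so the smaller
          pair would compete with the minimal one.\<close>
        then have "P (U', V')"
          using U' U V' unfolding P_def by auto
        from least[OF this] fV'(2) U(4) show False by simp
      qed
      with work[of U'] U' assms(4) show ?thesis by blast
    qed
  qed
  moreover have "U \<prec>\<^sub>l V"
  proof (rule lex_prec_if_Min_mem[OF assms(1) U(1,2) r])
    show "Min X \<notin> V"
      using r U(3) by blast
    \<comment> \<open>An empty \<open>V\<close> would force the finite set \<open>U\<close> to be
      empty, although it contains \<open>Min X\<close>.\<close>
    have "V \<noteq> {}"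
      using r U(4) fin by auto
    then show "V - U \<noteq> {}"
      using U(3) by blast
  qed
  moreover have "(\<Sum>S\<in>shift U V \<F>. i_lex X k S) < (\<Sum>S\<in>\<F>. i_lex X k S)"
    using assms(1,2) U r by (intro sum_i_lex_shift_less) auto
  ultimately have "satisfies_Q X k \<F> U V"
    using U unfolding satisfies_Q_def by blast
  with U(5,6) show ?thesis by blast
qed

section \<open>Non-full sets and the four claims\<close>

text \<open>The added elements lie beyond the maximum of \<open>C\<close>, so the union is disjoint
  and has exactly \<open>k\<close> elements.\<close>

lemma non_full_D:
  assumes "non_full X k \<F> C" "finite X" "C \<subseteq> X" "card C \<le> k"
  obtains E where "E \<in> nsets X k" "C \<subseteq> E" "E \<notin> \<F>"
proof -
  obtain D where D: "D \<subseteq> {x \<in> X. x > max0 C}" "card D = k - card C" "C \<union> D \<notin> \<F>"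
    using assms(1) unfolding non_full_def end_ext_def by blast
  have fin: "finite C" "finite D"
    using assms(2,3) D(1) by (auto intro: finite_subset)
  have "x \<le> max0 C" if "x \<in> C" for x
    using that fin(1) by (auto simp: max0_def)
  then have "C \<inter> D = {}"
    using D(1) by fastforce
  then have "card (C \<union> D) = k"
    using fin D(2) assms(4) by (simp add: card_Un_disjoint)
  then have "C \<union> D \<in> nsets X k"
    using fin assms(3) D(1) by (auto simp: nsets_def)
  with D(3) that show thesis by blast
qed

theorem lemma9p2:
  fixes n k i :: nat and X R T :: "nat set" and \<F> :: "nat set set"
  assumes "X \<subseteq> {1..n}" and "X \<noteq> {}"
    and "\<F> \<subseteq> nsets X k"
    and "R \<subseteq> X" and "T \<subseteq> X" and "card R < k" and "card T < k"
    and "R \<inter> T = {}" and "Min X \<in> R"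
    and "i \<in> X - R"
  shows
    "let r = Min X;
         P1 = (\<forall>U V. U \<subseteq> X \<longrightarrow> V \<subseteq> X \<longrightarrow> U \<inter> V = {} \<longrightarrow> card U = card V \<longrightarrow> r \<in> U \<longrightarrow>
                 shift U V \<F> \<noteq> \<F> \<longrightarrow> card V \<ge> card R);
         P2 = (\<exists>F\<in>\<F>. R \<inter> F = {});
         P3 = non_full X k \<F> R;
         P4 = non_full X k \<F> (R \<union> {i});
         P5 = (\<exists>F\<in>\<F>. R \<inter> F = {} \<and> i \<in> F);
         P6 = (\<exists>F\<in>\<F>. (R \<union> T) \<inter> F = {});
         P7 = (\<forall>F\<in>\<F>. (R \<union> T) \<inter> F = {} \<longrightarrow> i \<in> F)
     in
       (P1 \<and> P2 \<and> P3 \<longrightarrow>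
          (\<exists>U V. satisfies_Q X k \<F> U V \<and> R \<subseteq> U)) \<and>
       (P1 \<and> P2 \<and> P3 \<and> P4 \<and> P5 \<longrightarrow>
          (\<exists>U V. satisfies_Q X k \<F> U V \<and> R \<subseteq> U \<and> i \<notin> V)) \<and>
       (P1 \<and> P2 \<and> P3 \<and> P6 \<longrightarrow>
          (\<exists>U V. satisfies_Q X k \<F> U V \<and> T \<inter> V = {} \<and> R \<subseteq> U)) \<and>
       (P1 \<and> P2 \<and> P3 \<and> P4 \<and> P6 \<and> P7 \<longrightarrow>
          (\<exists>U V. satisfies_Q X k \<F> U V \<and> (T \<union> {i}) \<inter> V = {} \<and> R \<subseteq> U))"
proof -
  define P1 where "P1 \<longleftrightarrow> (\<forall>U V. U \<subseteq> X \<longrightarrow> V \<subseteq> X \<longrightarrow> U \<inter> V = {} \<longrightarrow> card U = card V \<longrightarrow>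
    Min X \<in> U \<longrightarrow> shift U V \<F> \<noteq> \<F> \<longrightarrow> card V \<ge> card R)"
  have fin: "finite X"
    using assms(1) finite_subset by blast
  have finR: "finite R"
    using assms(4) fin by (rule finite_subset)
  \<comment> \<open>Here \<open>C\<close> is \<open>R\<close> or \<open>R \<union> {i}\<close>. The
    missing set \<open>E\<close> contains \<open>C\<close>, so
    \<open>W \<inter> F \<subseteq> C\<close> keeps \<open>W\<close> away from
    \<open>F - E\<close>.\<close>
  have Q: "\<exists>U V. satisfies_Q X k \<F> U V \<and> W \<inter> V = {} \<and> R \<subseteq> U"
    if hyps: P1 "non_full X k \<F> C" "R \<subseteq> C" "C \<subseteq> R \<union> {i}" "F \<in> \<F>" "R \<inter> F = {}" "W \<inter> F \<subseteq> C" for C F W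
  proof -
    have "card C \<le> card (R \<union> {i})"
      using finR hyps(4) by (intro card_mono) auto
    \<comment> \<open>The strict bound \<open>card R < k\<close> leaves room for the one extra
      element \<open>i\<close>.\<close>
    also have "\<dots> \<le> k"
      using assms(6,10) finR by simp
    finally have "card C \<le> k" .
    moreover have "C \<subseteq> X"
      using hyps(4) assms(4,10) by blast
    ultimately obtain E where E: "E \<in> nsets X k" "C \<subseteq> E" "E \<notin> \<F>"
      using non_full_D[OF hyps(2) fin] by blast
    show ?thesis
    proof (rule exists_satisfies_Q[OF fin assms(3,4,9) _ E(1) _ E(3) hyps(5,6)])
      show "card R \<le> card V" if "U \<subseteq> X" "V \<subseteq> X" "U \<inter> V = {}" "card U = card V" "Min X \<in> U"
        "shift U V \<F> \<noteq> \<F>" for U V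
        using hyps(1) that unfolding P1_def by simp
    qed (use hyps E in blast)+
  qed
  show ?thesis
    unfolding Let_def P1_def[symmetric]
  proof (intro conjI impI; elim conjE)
    assume "P1" "non_full X k \<F> R" "\<exists>F\<in>\<F>. R \<inter> F = {}"
    then obtain F where "F \<in> \<F>" "R \<inter> F = {}" by blast
    with Q[of R F "{}"] \<open>P1\<close> \<open>non_full X k \<F> R\<close>
    show "\<exists>U V. satisfies_Q X k \<F> U V \<and> R \<subseteq> U" by auto
  next
    assume "P1" "non_full X k \<F> (R \<union> {i})" "\<exists>F\<in>\<F>. R \<inter> F = {} \<and> i \<in> F"
    then obtain F where "F \<in> \<F>" "R \<inter> F = {}" by blast
    \<comment> \<open>With \<open>C = R \<union> {i}\<close>, the element \<open>i\<close> lies in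
      \<open>E\<close> and so cannot enter \<open>V\<close> through \<open>F - E\<close>.\<close>
    with Q[of "R \<union> {i}" F "{i}"] \<open>P1\<close> \<open>non_full X k \<F> (R \<union> {i})\<close>
    show "\<exists>U V. satisfies_Q X k \<F> U V \<and> R \<subseteq> U \<and> i \<notin> V" by auto
  next
    assume "P1" "non_full X k \<F> R" "\<exists>F\<in>\<F>. (R \<union> T) \<inter> F = {}"
    then obtain F where "F \<in> \<F>" "R \<inter> F = {}" "T \<inter> F \<subseteq> R" by blast
    with Q[of R F T] \<open>P1\<close> \<open>non_full X k \<F> R\<close>
    show "\<exists>U V. satisfies_Q X k \<F> U V \<and> T \<inter> V = {} \<and> R \<subseteq> U" by auto
  next
    assume "P1" "non_full X k \<F> (R \<union> {i})" "\<exists>F\<in>\<F>. (R \<union> T) \<inter> F = {}"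
      "\<forall>F\<in>\<F>. (R \<union> T) \<inter> F = {} \<longrightarrow> i \<in> F"
    \<comment> \<open>As \<open>F\<close> misses \<open>T\<close>, only \<open>i\<close> can lie in
      both \<open>F\<close> and \<open>T \<union> {i}\<close>, and \<open>i\<close> is covered by
      \<open>C = R \<union> {i}\<close>.\<close>
    then obtain F where "F \<in> \<F>" "R \<inter> F = {}" "(T \<union> {i}) \<inter> F \<subseteq> R \<union> {i}" by blast
    with Q[of "R \<union> {i}" F "T \<union> {i}"] \<open>P1\<close> \<open>non_full X k \<F> (R \<union> {i})\<close>
    show "\<exists>U V. satisfies_Q X k \<F> U V \<and> (T \<union> {i}) \<inter> V = {} \<and> R \<subseteq> U" by blast
  qed
qed

end
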